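(* Let $\{T_{mn}\}_{m,n\in\mathbb{N}}$ be a double sequence of fuzzy positive linear operators from $C_{2\pi}^{(\mathcal{F})}(\mathbb{R}^2)$ into itself, and suppose there is a corresponding double sequence $\{\widetilde{T}_{mn}\}_{m,n\in\mathbb{N}}$ of positive linear operators from $C_{2\pi}(\mathbb{R}^2)$ into itself such that $$\left\{T_{mn}(f;u,v)\right\}_\alpha^{-}=\widetilde{T}_{mn}(f_\alpha^{-};u,v)\quad\text{and}\quad \left\{T_{mn}(f;u,v)\right\}_\alpha^{+}=\widetilde{T}_{mn}(f_\alpha^{+};u,v)$$ for all $m,n$, all $(u,v)\in\mathbb{R}^2$, all $\alpha\in[0,1]$ and all $f\in C_{2\pi}^{(\mathcal{F})}(\mathbb{R}^2)$. If $$\lim_{m,n\to\infty}\Vert\widetilde{T}_{mn}(f_{i})-f_{i}\Vert=0\qquad (i=0,1,2,3,4)$$ for the functions $f_0(u,v)=1$, $f_1(u,v)=\sin u$, $f_2(u,v)=\sin v$, $f_3(u,v)=\cos u$, $f_4(u,v)=\cos v$, then for all $f\in C_{2\pi}^{(\mathcal{F})}(\mathbb{R}^2)$ $$\lim_{m,n\to\infty} D^{*}\left(T_{mn}(f),f\right)=0.$$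
   Context: A fuzzy number is a function $\mu:\mathbb{R}\to[0,1]$ that is normal ($\mu(t_0)=1$ for some $t_0$), fuzzy convex ($\mu(\lambda s+(1-\lambda)t)\ge\min\{\mu(s),\mu(t)\}$ for $\lambda\in[0,1]$), upper semicontinuous, and has compact support $\overline{\{t:\mu(t)>0\}}$. $\mathbb{R}_{\mathcal{F}}$ is the set of fuzzy numbers. The $\alpha$-level set is $[\mu]_\alpha=\{t:\mu(t)\ge\alpha\}$ for $0<\alpha\le1$ and $[\mu]_0=\overline{\{t:\mu(t)>0\}}$; it is a compact interval written $[\mu]_\alpha=[\mu_\alpha^-,\mu_\alpha^+]$ (also $\{\mu\}_\alpha^{\mp}$ for the endpoints $\mu_\alpha^{\mp}$). Addition and scalar multiplication by $k\in\mathbb{R}$ are levelwise: $[\mu+\eta]_\alpha=[\mu]_\alpha+[\eta]_\alpha$, $[k\mu]_\alpha=k[\mu]_\alpha$. The partial order is $\mu\preceq\eta$ iff $\mu_\alpha^-\le\eta_\alpha^-$ and $\mu_\alpha^+\le\eta_\alpha^+$ for all $\alpha\in[0,1]$. The metric is $D(\mu,\eta)=\sup_{\alpha\in[0,1]}\max\{|\mu_\alpha^--\eta_\alpha^-|,|\mu_\alpha^+-\eta_\alpha^+|\}$. A function on $\mathbb{R}^2$ is $2\pi$-periodic if $f(u,v)=f(u+2n\pi,v)=f(u,v+2n\pi)$ for all $n\in\mathbb{Z}$ and all $(u,v)$. $C_{2\pi}(\mathbb{R}^2)$ is the set of $2\pi$-periodic continuous real valued functions on $\mathbb{R}^2$ with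 the norm $\Vert f\Vert=\sup_{(u,v)\in\mathbb{R}^2}|f(u,v)|$. $C_{2\pi}^{(\mathcal{F})}(\mathbb{R}^2)$ is the set of $2\pi$-periodic functions $f:\mathbb{R}^2\to\mathbb{R}_{\mathcal{F}}$ that are continuous with respect to $D$, with the metric $D^*(f,g)=\sup_{(u,v)\in\mathbb{R}^2}D(f(u,v),g(u,v))$. For such $f$, $f_\alpha^{\mp}$ denote the real valued endpoint functions given by $[f(u,v)]_\alpha=[f_\alpha^-(u,v),f_\alpha^+(u,v)]$; they belong to $C_{2\pi}(\mathbb{R}^2)$. For an operator $T$, $T(f;u,v)$ denotes the value of $T(f)$ at $(u,v)$. An operator $T:C_{2\pi}^{(\mathcal{F})}(\mathbb{R}^2)\to C_{2\pi}^{(\mathcal{F})}(\mathbb{R}^2)$ is fuzzy linear if $T(k_1f_1+k_2f_2;u,v)=k_1T(f_1;u,v)+k_2T(f_2;u,v)$ for all $k_1,k_2\in\mathbb{R}$, all $f_1,f_2$ and all $(u,v)$; it is fuzzy positive linear if it is fuzzy linear and, whenever $f(u,v)\preceq g(u,v)$ for all $(u,v)\in\mathbb{R}^2$, one has $T(f;u,v)\preceq T(g;u,v)$ for all $(u,v)\in\mathbb{R}^2$. A positive linear operator on $C_{2\pi}(\mathbb{R}^2)$ is a linear operator mapping nonnegative functions to nonnegative functions. Limits of double sequences are in the Pringsheim sense: $\lim_{m,n\to\infty}x_{mn}=L$ means that for every $\varepsilon>0$ there is $N$ with $|x_{mn}-L|<\varepsilon$ for all $m,n\ge N$. *)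

theory Defs
  imports "HOL-Analysis.Analysis"
begin

section \<open>Fuzzy numbers\<close>

definition upper_semicontinuous :: "('a::topological_space \<Rightarrow> real) \<Rightarrow> bool" where
  "upper_semicontinuous \<mu> \<longleftrightarrow> (\<forall>t. \<forall>y>\<mu> t. \<forall>\<^sub>F s in nhds t. \<mu> s < y)"

definition is_fuzzy_number :: "(real \<Rightarrow> real) \<Rightarrow> bool" where
  "is_fuzzy_number \<mu> \<longleftrightarrow>
     (\<forall>t. 0 \<le> \<mu> t \<and> \<mu> t \<le> 1) \<and>
     (\<exists>t. \<mu> t = 1) \<and>
     (\<forall>s t. \<forall>l\<in>{0..1}. \<mu> (l * s + (1 - l) * t) \<ge> min (\<mu> s) (\<mu> t)) \<and>
     upper_semicontinuous \<mu> \<and>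
     compact (closure {t. \<mu> t > 0})"

lemma is_fuzzy_number_levelI:
  assumes "\<And>t. 0 \<le> \<mu> t \<and> \<mu> t \<le> 1" "\<mu> t0 = 1"
    and cl: "\<And>\<alpha>. 0 < \<alpha> \<Longrightarrow> \<alpha> \<le> 1 \<Longrightarrow> closed {t. \<mu> t \<ge> \<alpha>}"
    and cv: "\<And>\<alpha>. 0 < \<alpha> \<Longrightarrow> \<alpha> \<le> 1 \<Longrightarrow> convex {t. \<mu> t \<ge> \<alpha>}"
    and bd: "bounded {t. \<mu> t > 0}"
  shows "is_fuzzy_number \<mu>"
  unfolding is_fuzzy_number_def
proof (intro conjI allI ballI)
  fix t show "0 \<le> \<mu> t" "\<mu> t \<le> 1" using assms(1) by auto
next
  show "\<exists>t. \<mu> t = 1" using assms(2) by auto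
next
  fix s t l :: real assume l: "l \<in> {0..1}"
  show "\<mu> (l * s + (1 - l) * t) \<ge> min (\<mu> s) (\<mu> t)"
  proof (cases "min (\<mu> s) (\<mu> t) > 0")
    case True
    have "convex {x. \<mu> x \<ge> min (\<mu> s) (\<mu> t)}"
      using True assms(1)[of s] by (intro cv) auto
    from convexD[OF this, of s t l "1 - l"] l show ?thesis by auto
  next
    case False
    then show ?thesis using assms(1)[of "l * s + (1 - l) * t"] by linarith
  qed
next
  show "upper_semicontinuous \<mu>"
    unfolding upper_semicontinuous_def
  proof (intro allI impI)
    fix t y assume y: "\<mu> t < y"
    show "\<forall>\<^sub>F s in nhds t. \<mu> s < y"
    proof (cases "y \<le> 1")
      case True
      have "0 < y" using y assms(1)[of t] by linarith
      then have "open (- {t. \<mu> t \<ge> y})" using cl True by (simp add: open_Compl)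
      from eventually_nhds_in_open[OF this, of t] y show ?thesis
        by (auto simp: not_le elim: eventually_mono)
    next
      case False
      then have "\<mu> s < y" for s using assms(1)[of s] by linarith
      then show ?thesis by simp
    qed
  qed
next
  show "compact (closure {t. \<mu> t > 0})" using bd by simp
qed

typedef fuzzy = "{\<mu>. is_fuzzy_number \<mu>}"
  morphisms membership Fuzzy
proof -
  have "is_fuzzy_number (\<lambda>t. if t = 0 then 1 else 0)"
  proof (rule is_fuzzy_number_levelI)
    fix \<alpha> :: real assume "0 < \<alpha>" "\<alpha> \<le> 1"
    then have "{t::real. \<alpha> \<le> (if t = 0 then 1 else 0)} = {0}" by auto
    then show "closed {t::real. \<alpha> \<le> (if t = 0 then 1 else 0)}"
      and "convex {t::real. \<alpha> \<le> (if t = 0 then 1 else 0)}" by simp_all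
  next
    have "{t::real. 0 < (if t = 0 then 1 else (0::real))} = {0}" by auto
    then show "bounded {t::real. 0 < (if t = 0 then 1 else (0::real))}" by simp
  qed auto
  then show ?thesis by auto
qed

definition level :: "fuzzy \<Rightarrow> real \<Rightarrow> real set" where
  "level \<mu> \<alpha> =
     (if \<alpha> = 0 then closure {t. membership \<mu> t > 0} else {t. membership \<mu> t \<ge> \<alpha>})"

definition lower :: "fuzzy \<Rightarrow> real \<Rightarrow> real" where
  "lower \<mu> \<alpha> = Inf (level \<mu> \<alpha>)"

definition upper :: "fuzzy \<Rightarrow> real \<Rightarrow> real" where
  "upper \<mu> \<alpha> = Sup (level \<mu> \<alpha>)"

lemma membership_fuzzy: "is_fuzzy_number (membership \<mu>)"
  using membership by auto

lemma membership_bounds: "0 \<le> membership \<mu> t" "membership \<mu> t \<le> 1"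
  using membership_fuzzy[of \<mu>] by (auto simp: is_fuzzy_number_def)

lemma membership_normal: "\<exists>t. membership \<mu> t = 1"
  using membership_fuzzy[of \<mu>] by (auto simp: is_fuzzy_number_def)

lemma level_subset_level_0: "0 \<le> \<alpha> \<Longrightarrow> level \<mu> \<alpha> \<subseteq> level \<mu> 0"
  using closure_subset[of "{t. membership \<mu> t > 0}"] by (auto simp: level_def)

lemma level_nonempty: "\<alpha> \<in> {0..1} \<Longrightarrow> level \<mu> \<alpha> \<noteq> {}"
proof -
  assume \<alpha>: "\<alpha> \<in> {0..1}"
  obtain t where "membership \<mu> t = 1" using membership_normal by blast
  then have "t \<in> level \<mu> \<alpha>"
    using \<alpha> closure_subset[of "{t. membership \<mu> t > 0}"] by (auto simp: level_def)
  then show ?thesis by auto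
qed

lemma closed_superlevel: "closed {t. membership \<mu> t \<ge> \<alpha>}"
proof -
  have "open (- {t. membership \<mu> t \<ge> \<alpha>})"
  proof (subst open_subopen, rule ballI)
    fix t assume "t \<in> - {t. membership \<mu> t \<ge> \<alpha>}"
    then have "\<forall>\<^sub>F s in nhds t. membership \<mu> s < \<alpha>"
      using membership_fuzzy[of \<mu>]
      by (auto simp: is_fuzzy_number_def upper_semicontinuous_def)
    then show "\<exists>T. open T \<and> t \<in> T \<and> T \<subseteq> - {t. membership \<mu> t \<ge> \<alpha>}"
      by (force simp: eventually_nhds)
  qed
  then show ?thesis by (simp add: closed_def)
qed

lemma convex_level: "0 \<le> \<alpha> \<Longrightarrow> convex (level \<mu> \<alpha>)"
proof -
  have *: "min (membership \<mu> s) (membership \<mu> t) \<le> membership \<mu> ((1 - u) * s + u * t)"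
    if "0 \<le> u" "u \<le> 1" for s t u
  proof -
    have "\<forall>s t. \<forall>l\<in>{0..1}. membership \<mu> (l * s + (1 - l) * t) \<ge> min (membership \<mu> s) (membership \<mu> t)"
      using membership_fuzzy[of \<mu>] unfolding is_fuzzy_number_def by blast
    from this[rule_format, of "1 - u" s t] that show ?thesis by auto
  qed
  have 0: "convex {t. membership \<mu> t > 0}"
    unfolding convex_alt
  proof (intro ballI allI impI)
    fix x y u :: real
    assume "x \<in> {t. membership \<mu> t > 0}" "y \<in> {t. membership \<mu> t > 0}" "0 \<le> u \<and> u \<le> 1"
    then show "(1 - u) *\<^sub>R x + u *\<^sub>R y \<in> {t. membership \<mu> t > 0}"
      using *[of u x y] by (simp add: min_def split: if_splits)
  qed
  have "convex {t. membership \<mu> t \<ge> \<alpha>}"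
    unfolding convex_alt
  proof (intro ballI allI impI)
    fix x y u :: real
    assume "x \<in> {t. membership \<mu> t \<ge> \<alpha>}" "y \<in> {t. membership \<mu> t \<ge> \<alpha>}" "0 \<le> u \<and> u \<le> 1"
    then show "(1 - u) *\<^sub>R x + u *\<^sub>R y \<in> {t. membership \<mu> t \<ge> \<alpha>}"
      using *[of u x y] by (simp add: min_def split: if_splits)
  qed
  then show ?thesis using 0 by (simp add: level_def convex_closure)
qed

lemma compact_level: "0 \<le> \<alpha> \<Longrightarrow> compact (level \<mu> \<alpha>)"
proof -
  assume \<alpha>: "0 \<le> \<alpha>"
  have 0: "compact (level \<mu> 0)"
    using membership_fuzzy[of \<mu>] by (simp add: is_fuzzy_number_def level_def)
  have "closed (level \<mu> \<alpha>)" by (simp add: level_def closed_superlevel)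
  with 0 level_subset_level_0[OF \<alpha>] show ?thesis
    by (metis compact_Int_closed inf.absorb_iff2)
qed

lemma level_eq_interval:
  assumes "\<alpha> \<in> {0..1}"
  shows "level \<mu> \<alpha> = {lower \<mu> \<alpha>..upper \<mu> \<alpha>}" "lower \<mu> \<alpha> \<le> upper \<mu> \<alpha>"
proof -
  have "connected (level \<mu> \<alpha>) \<and> compact (level \<mu> \<alpha>)"
    using assms by (simp add: compact_level convex_level convex_connected)
  then obtain a b where ab: "level \<mu> \<alpha> = {a..b}"
    using connected_compact_interval_1 by blast
  moreover have "a \<le> b" using level_nonempty[OF assms] ab by force
  ultimately show "level \<mu> \<alpha> = {lower \<mu> \<alpha>..upper \<mu> \<alpha>}" "lower \<mu> \<alpha> \<le> upper \<mu> \<alpha>"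
    by (auto simp: lower_def upper_def)
qed

lemma fuzzy_eqI_level:
  assumes "\<And>\<alpha>. \<alpha> \<in> {0..1} \<Longrightarrow> level \<mu> \<alpha> = level \<eta> \<alpha>"
  shows "\<mu> = \<eta>"
proof -
  have le: "membership \<mu> t \<le> membership \<eta> t"
    if "\<And>\<alpha>. \<alpha> \<in> {0..1} \<Longrightarrow> level \<mu> \<alpha> = level \<eta> \<alpha>" for \<mu> \<eta> t
  proof (cases "membership \<mu> t > 0")
    case True
    then have "t \<in> level \<mu> (membership \<mu> t)" by (simp add: level_def)
    also have "\<dots> = level \<eta> (membership \<mu> t)" using that membership_bounds by simp
    finally show ?thesis using True by (simp add: level_def)
  next
    case False
    then show ?thesis using membership_bounds(1)[of \<eta> t] by linarith
  qed
  have "membership \<mu> = membership \<eta>"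
    using le[OF assms] le[OF assms[symmetric]] by (auto intro!: ext antisym)
  then show ?thesis by (simp add: membership_inject)
qed

lemma fuzzy_eqI:
  assumes "\<And>\<alpha>. \<alpha> \<in> {0..1} \<Longrightarrow> lower \<mu> \<alpha> = lower \<eta> \<alpha> \<and> upper \<mu> \<alpha> = upper \<eta> \<alpha>"
  shows "\<mu> = \<eta>"
  using assms by (intro fuzzy_eqI_level) (simp add: level_eq_interval)


section \<open>Levelwise arithmetic\<close>

text \<open>Both operations are characterised by their level sets; that the description has a
  (unique) solution is shown right below.\<close>

instantiation fuzzy :: "{plus, scaleR}"
begin

definition plus_fuzzy :: "fuzzy \<Rightarrow> fuzzy \<Rightarrow> fuzzy" where
  "\<mu> + \<eta> = (THE \<omega>. \<forall>\<alpha>\<in>{0..1}.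
     level \<omega> \<alpha> = {s + t |s t. s \<in> level \<mu> \<alpha> \<and> t \<in> level \<eta> \<alpha>})"

definition scaleR_fuzzy :: "real \<Rightarrow> fuzzy \<Rightarrow> fuzzy" where
  "k *\<^sub>R \<mu> = (THE \<omega>. \<forall>\<alpha>\<in>{0..1}. level \<omega> \<alpha> = (\<lambda>t. k * t) ` level \<mu> \<alpha>)"

instance ..

end

lemma plus_fuzzy_exists:
  "\<exists>\<omega>. \<forall>\<alpha>\<in>{0..1}. level \<omega> \<alpha> = {s + t |s t. s \<in> level \<mu> \<alpha> \<and> t \<in> level \<eta> \<alpha>}"
proof -
  define S where "S = (\<lambda>\<alpha>. {s + t |s t. s \<in> level \<mu> \<alpha> \<and> t \<in> level \<eta> \<alpha>})"
  define h where "h = (\<lambda>t s. min (membership \<mu> s) (membership \<eta> (t - s)))"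
  define w where "w = (\<lambda>t. SUP s. h t s)"
  have h01: "0 \<le> h t s" "h t s \<le> 1" for t s
    using membership_bounds by (auto simp: h_def min_def)
  have bdd: "bdd_above (range (h t))" for t using h01 by (intro bdd_aboveI) auto
  have w_ge: "h t s \<le> w t" for t s unfolding w_def by (intro cSUP_upper bdd) auto
  have w01: "0 \<le> w t \<and> w t \<le> 1" for t
  proof
    show "0 \<le> w t" using w_ge[of t 0] h01[of t 0] by linarith
    show "w t \<le> 1" unfolding w_def by (intro cSUP_least) (use h01 in auto)
  qed
  have closed_h: "closed {s. h t s \<ge> \<beta>}" for t \<beta>
  proof -
    have "closed ((\<lambda>s. t - s) -` {x. membership \<eta> x \<ge> \<beta>})"
      by (intro continuous_closed_vimage closed_superlevel) (auto intro!: continuous_intros)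
    moreover have "{s. h t s \<ge> \<beta>} =
      {s. membership \<mu> s \<ge> \<beta>} \<inter> (\<lambda>s. t - s) -` {x. membership \<eta> x \<ge> \<beta>}"
      by (auto simp: h_def)
    ultimately show ?thesis using closed_superlevel by (simp add: closed_Int)
  qed
  have attain: "\<exists>s. h t s \<ge> \<alpha>" if a: "0 < \<alpha>" "\<alpha> \<le> w t" for \<alpha> t
  proof -
    define F where "F = (\<lambda>n::nat. {s. h t s \<ge> \<alpha> - \<alpha> / (n + 2)})"
    have pos: "0 < \<alpha> - \<alpha> / (real n + 2)" for n using a(1) by (simp add: field_simps add_pos_nonneg)
    have "(\<Inter>n. F n) \<noteq> {}"
    proof (rule compact_nest)
      fix n
      have "F n \<subseteq> level \<mu> 0"
        using pos[of n] level_subset_level_0[of "\<alpha> - \<alpha> / (real n + 2)" \<mu>]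
        by (auto simp: F_def h_def level_def)
      then show "compact (F n)"
        using compact_level[of 0 \<mu>] closed_h[of "\<alpha> - \<alpha> / (real n + 2)" t]
        unfolding F_def by (metis (no_types, lifting) compact_Int_closed inf.absorb_iff2 order_refl)
      have "\<alpha> - \<alpha> / (real n + 2) < (SUP s. h t s)"
        using a by (simp add: w_def) (smt (verit) divide_pos_pos of_nat_0_le_iff)
      then show "F n \<noteq> {}"
        using less_cSUP_iff[OF _ bdd[of t], of "\<alpha> - \<alpha> / (real n + 2)"] unfolding F_def
        by (auto intro: less_imp_le)
    next
      fix m n :: nat assume "m \<le> n"
      then have "\<alpha> / (real n + 2) \<le> \<alpha> / (real m + 2)" using a by (intro divide_left_mono) auto
      then show "F n \<subseteq> F m" by (auto simp: F_def)
    qed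
    then obtain s where s: "\<And>n. h t s \<ge> \<alpha> - \<alpha> / (real n + 2)" by (auto simp: F_def)
    have "\<alpha> \<le> h t s"
    proof (rule ccontr)
      assume "\<not> \<alpha> \<le> h t s"
      then have d: "0 < \<alpha> - h t s" by simp
      obtain n :: nat where "\<alpha> / (\<alpha> - h t s) < real n" using reals_Archimedean2 by blast
      then have "\<alpha> < (real n + 2) * (\<alpha> - h t s)" using d by (simp add: field_simps)
      then have "\<alpha> / (real n + 2) < \<alpha> - h t s" by (simp add: pos_divide_less_eq mult.commute)
      then show False using s[of n] by simp
    qed
    then show ?thesis by blast
  qed
  have lev: "{t. w t \<ge> \<alpha>} = S \<alpha>" if apos: "0 < \<alpha>" for \<alpha>
  proof (intro equalityI subsetI)
    fix t assume "t \<in> {t. w t \<ge> \<alpha>}"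
    then obtain s where "h t s \<ge> \<alpha>" using attain[OF apos, of t] by auto
    then have "s \<in> level \<mu> \<alpha>" "t - s \<in> level \<eta> \<alpha>" using that by (auto simp: h_def level_def)
    then show "t \<in> S \<alpha>" unfolding S_def by force
  next
    fix t assume "t \<in> S \<alpha>"
    then obtain s r where "t = s + r" "s \<in> level \<mu> \<alpha>" "r \<in> level \<eta> \<alpha>" by (auto simp: S_def)
    then have "h t s \<ge> \<alpha>" using that by (auto simp: h_def level_def)
    then show "t \<in> {t. w t \<ge> \<alpha>}" using w_ge[of t s] by auto
  qed
  let ?A = "{t. membership \<mu> t > 0}" and ?B = "{t. membership \<eta> t > 0}"
  have Splus: "S \<alpha> = level \<mu> \<alpha> + level \<eta> \<alpha>" for \<alpha> by (auto simp: S_def set_plus_def)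
  have compS: "compact (S \<alpha>)" if "0 \<le> \<alpha>" for \<alpha>
    unfolding S_def by (intro compact_sums compact_level that)
  have pos: "{t. w t > 0} = ?A + ?B"
  proof (intro equalityI subsetI)
    fix t assume "t \<in> {t. w t > 0}"
    then have t: "w t > 0" by simp
    then have "t \<in> S (w t)" using lev[OF t] by auto
    then show "t \<in> ?A + ?B" using t by (force simp: S_def level_def set_plus_def)
  next
    fix t assume "t \<in> ?A + ?B"
    then obtain s r where "t = s + r" "s \<in> ?A" "r \<in> ?B" by (auto simp: set_plus_def)
    then have "h t s > 0" by (auto simp: h_def)
    then show "t \<in> {t. w t > 0}" using w_ge[of t s] by auto
  qed
  have lev0: "closure {t. w t > 0} = S 0"
  proof
    have "?A + ?B \<subseteq> S 0"
      unfolding Splus level_def using set_plus_mono2[OF closure_subset closure_subset, of ?A ?B] by simp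
    then show "closure {t. w t > 0} \<subseteq> S 0"
      unfolding pos using compS[of 0] by (intro closure_minimal compact_imp_closed) auto
    show "S 0 \<subseteq> closure {t. w t > 0}"
      unfolding pos Splus level_def using closure_sum[of ?A ?B] by simp
  qed
  obtain a b where ab: "membership \<mu> a = 1" "membership \<eta> b = 1" using membership_normal by metis
  have "is_fuzzy_number w"
  proof (rule is_fuzzy_number_levelI)
    show "w (a + b) = 1" using w_ge[of "a + b" a] ab w01[of "a + b"] by (simp add: h_def)
    show "bounded {t. w t > 0}"
      using compS[of 0] lev0 closure_subset by (metis bounded_subset compact_imp_bounded order_refl)
    fix \<alpha> :: real assume "0 < \<alpha>" "\<alpha> \<le> 1"
    then show "closed {t. w t \<ge> \<alpha>}" using lev compS by (simp add: compact_imp_closed)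
    show "convex {t. w t \<ge> \<alpha>}"
      using lev \<open>0 < \<alpha>\<close> by (simp add: Splus convex_set_plus convex_level)
  qed (rule w01)
  then have "membership (Fuzzy w) = w" by (simp add: Fuzzy_inverse)
  then have "\<forall>\<alpha>\<in>{0..1}. level (Fuzzy w) \<alpha> = S \<alpha>"
    using lev lev0 by (auto simp: level_def)
  then show ?thesis unfolding S_def by blast
qed

lemma level_plus:
  assumes "\<alpha> \<in> {0..1}"
  shows "level (\<mu> + \<eta>) \<alpha> = {s + t |s t. s \<in> level \<mu> \<alpha> \<and> t \<in> level \<eta> \<alpha>}"
proof -
  have "\<exists>!\<omega>. \<forall>\<alpha>\<in>{0..1}. level \<omega> \<alpha> = {s + t |s t. s \<in> level \<mu> \<alpha> \<and> t \<in> level \<eta> \<alpha>}"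
    using plus_fuzzy_exists[of \<mu> \<eta>] by (rule ex_ex1I) (auto intro!: fuzzy_eqI_level)
  from theI'[OF this] assms show ?thesis unfolding plus_fuzzy_def by blast
qed

lemma scaleR_fuzzy_exists:
  "\<exists>\<omega>. \<forall>\<alpha>\<in>{0..1}. level \<omega> \<alpha> = (\<lambda>t. k * t) ` level \<mu> \<alpha>"
proof -
  define w where "w = (\<lambda>t. if k = 0 then (if t = 0 then 1 else 0) else membership \<mu> (t / k))"
  have lev: "{t. w t \<ge> \<alpha>} = (\<lambda>t. k * t) ` level \<mu> \<alpha>" if "0 < \<alpha>" "\<alpha> \<le> 1" for \<alpha>
  proof (cases "k = 0")
    case True
    have "(\<lambda>t. k * t) ` level \<mu> \<alpha> = {0}" using True level_nonempty[of \<alpha> \<mu>] that by auto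
    then show ?thesis using True that by (auto simp: w_def)
  next
    case False
    show ?thesis
    proof (intro equalityI subsetI)
      fix t assume "t \<in> {t. w t \<ge> \<alpha>}"
      then have "t / k \<in> level \<mu> \<alpha>" using False that by (auto simp: w_def level_def)
      then show "t \<in> (\<lambda>t. k * t) ` level \<mu> \<alpha>" using False by (intro image_eqI[of _ _ "t / k"]) auto
    qed (use False that in \<open>auto simp: w_def level_def\<close>)
  qed
  have lev0: "closure {t. w t > 0} = (\<lambda>t. k * t) ` level \<mu> 0"
  proof (cases "k = 0")
    case True
    have "(\<lambda>t. k * t) ` level \<mu> 0 = {0}" using True level_nonempty[of 0 \<mu>] by auto
    moreover have "{t. w t > 0} = {0}" using True by (auto simp: w_def)
    ultimately show ?thesis by simp
  next
    case False
    have "{t. w t > 0} = (*\<^sub>R) k ` {t. membership \<mu> t > 0}"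
    proof (intro equalityI subsetI)
      fix t assume "t \<in> {t. w t > 0}"
      then show "t \<in> (*\<^sub>R) k ` {t. membership \<mu> t > 0}"
        using False by (intro image_eqI[of _ _ "t / k"]) (auto simp: w_def)
    qed (use False in \<open>auto simp: w_def\<close>)
    then show ?thesis using closure_scaleR[of k "{t. membership \<mu> t > 0}"] by (simp add: level_def)
  qed
  have comp: "compact ((\<lambda>t. k * t) ` level \<mu> \<alpha>)" if "0 \<le> \<alpha>" for \<alpha>
    by (intro compact_continuous_image compact_level that continuous_intros)
  obtain a where a: "membership \<mu> a = 1" using membership_normal by metis
  have "is_fuzzy_number w"
  proof (rule is_fuzzy_number_levelI)
    show "0 \<le> w t \<and> w t \<le> 1" for t using membership_bounds by (simp add: w_def)
    show "w (k * a) = 1" using a by (simp add: w_def)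
    show "bounded {t. w t > 0}"
      using comp[of 0] lev0 closure_subset by (metis bounded_subset compact_imp_bounded order_refl)
    fix \<alpha> :: real assume \<alpha>: "0 < \<alpha>" "\<alpha> \<le> 1"
    then show "closed {t. w t \<ge> \<alpha>}" using lev comp by (simp add: compact_imp_closed)
    show "convex {t. w t \<ge> \<alpha>}"
      using lev \<alpha> convex_scaling[OF convex_level[of \<alpha> \<mu>], of k] by simp
  qed
  then have "membership (Fuzzy w) = w" by (simp add: Fuzzy_inverse)
  then have "\<forall>\<alpha>\<in>{0..1}. level (Fuzzy w) \<alpha> = (\<lambda>t. k * t) ` level \<mu> \<alpha>"
    using lev lev0 by (auto simp: level_def)
  then show ?thesis by blast
qed

lemma level_scaleR:
  assumes "\<alpha> \<in> {0..1}"
  shows "level (k *\<^sub>R \<mu>) \<alpha> = (\<lambda>t. k * t) ` level \<mu> \<alpha>"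
proof -
  have "\<exists>!\<omega>. \<forall>\<alpha>\<in>{0..1}. level \<omega> \<alpha> = (\<lambda>t. k * t) ` level \<mu> \<alpha>"
    using scaleR_fuzzy_exists[of k \<mu>] by (rule ex_ex1I) (auto intro!: fuzzy_eqI_level)
  from theI'[OF this] assms show ?thesis unfolding scaleR_fuzzy_def by blast
qed


section \<open>Order and metric\<close>

instantiation fuzzy :: order
begin

definition less_eq_fuzzy :: "fuzzy \<Rightarrow> fuzzy \<Rightarrow> bool" where
  "\<mu> \<le> \<eta> \<longleftrightarrow> (\<forall>\<alpha>\<in>{0..1}. lower \<mu> \<alpha> \<le> lower \<eta> \<alpha> \<and> upper \<mu> \<alpha> \<le> upper \<eta> \<alpha>)"

definition less_fuzzy :: "fuzzy \<Rightarrow> fuzzy \<Rightarrow> bool" where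
  "(\<mu>::fuzzy) < \<eta> \<longleftrightarrow> \<mu> \<le> \<eta> \<and> \<not> \<eta> \<le> \<mu>"

instance
proof
  fix x y z :: fuzzy
  show "x < y \<longleftrightarrow> x \<le> y \<and> \<not> y \<le> x" by (rule less_fuzzy_def)
  show "x \<le> x" by (simp add: less_eq_fuzzy_def)
  show "x \<le> y \<Longrightarrow> y \<le> z \<Longrightarrow> x \<le> z" unfolding less_eq_fuzzy_def by fastforce
  show "x \<le> y \<Longrightarrow> y \<le> x \<Longrightarrow> x = y"
    unfolding less_eq_fuzzy_def by (intro fuzzy_eqI) (auto intro: antisym)
qed

end

lemma bdd_above_endpoint_distances:
  "bdd_above ((\<lambda>\<alpha>. max \<bar>lower \<mu> \<alpha> - lower \<eta> \<alpha>\<bar> \<bar>upper \<mu> \<alpha> - upper \<eta> \<alpha>\<bar>) ` {0..1})"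
proof (rule bdd_aboveI2)
  fix \<alpha> :: real assume \<alpha>: "\<alpha> \<in> {0..1}"
  have "{lower \<nu> \<alpha>..upper \<nu> \<alpha>} \<subseteq> {lower \<nu> 0..upper \<nu> 0}" for \<nu>
    using \<alpha> level_subset_level_0[of \<alpha> \<nu>] level_eq_interval(1)[of \<alpha> \<nu>] level_eq_interval(1)[of 0 \<nu>]
    by simp
  then have "lower \<nu> 0 \<le> lower \<nu> \<alpha> \<and> upper \<nu> \<alpha> \<le> upper \<nu> 0" for \<nu>
    using level_eq_interval(2)[OF \<alpha>, of \<nu>] by simp
  from this[of \<mu>] this[of \<eta>] level_eq_interval(2)[OF \<alpha>, of \<mu>] level_eq_interval(2)[OF \<alpha>, of \<eta>]
  show "max \<bar>lower \<mu> \<alpha> - lower \<eta> \<alpha>\<bar> \<bar>upper \<mu> \<alpha> - upper \<eta> \<alpha>\<bar>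
      \<le> \<bar>lower \<mu> 0\<bar> + \<bar>upper \<mu> 0\<bar> + \<bar>lower \<eta> 0\<bar> + \<bar>upper \<eta> 0\<bar>"
    by linarith
qed

text \<open>The distance below is the metric $D$, so that continuity with respect to $D$ is
  the library's continuity.\<close>

instantiation fuzzy :: metric_space
begin

definition dist_fuzzy :: "fuzzy \<Rightarrow> fuzzy \<Rightarrow> real" where
  "dist \<mu> \<eta> = (SUP \<alpha>\<in>{0..1}. max \<bar>lower \<mu> \<alpha> - lower \<eta> \<alpha>\<bar> \<bar>upper \<mu> \<alpha> - upper \<eta> \<alpha>\<bar>)"

definition uniformity_fuzzy :: "(fuzzy \<times> fuzzy) filter" where
  "uniformity_fuzzy = (INF e\<in>{0<..}. principal {(x, y). dist x y < e})"

definition open_fuzzy :: "fuzzy set \<Rightarrow> bool" where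
  "open_fuzzy U \<longleftrightarrow> (\<forall>x\<in>U. \<forall>\<^sub>F (x', y) in uniformity. x' = x \<longrightarrow> y \<in> U)"

instance
proof
  have le: "\<bar>lower x \<alpha> - lower y \<alpha>\<bar> \<le> dist x y \<and> \<bar>upper x \<alpha> - upper y \<alpha>\<bar> \<le> dist x y"
    if "\<alpha> \<in> {0..1}" for x y :: fuzzy and \<alpha>
    using cSUP_upper[OF that bdd_above_endpoint_distances[of x y]] by (simp add: dist_fuzzy_def)
  fix x y z :: fuzzy
  show "dist x y = 0 \<longleftrightarrow> x = y"
  proof
    assume "dist x y = 0"
    then show "x = y" using le[of _ x y] by (intro fuzzy_eqI) force
  qed (simp add: dist_fuzzy_def)
  show "dist x y \<le> dist x z + dist y z"
    unfolding dist_fuzzy_def[of x y]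
  proof (rule cSUP_least)
    fix \<alpha> :: real assume "\<alpha> \<in> {0..1}"
    from le[OF this, of x z] le[OF this, of y z]
    show "max \<bar>lower x \<alpha> - lower y \<alpha>\<bar> \<bar>upper x \<alpha> - upper y \<alpha>\<bar> \<le> dist x z + dist y z"
      by linarith
  qed simp
qed (rule uniformity_fuzzy_def open_fuzzy_def)+

end


section \<open>Periodic functions on the plane\<close>

definition periodic_2pi :: "(real \<times> real \<Rightarrow> 'a) \<Rightarrow> bool" where
  "periodic_2pi f \<longleftrightarrow> (\<forall>u v. \<forall>n::int.
     f (u, v) = f (u + 2 * of_int n * pi, v) \<and> f (u, v) = f (u, v + 2 * of_int n * pi))"

text \<open>\<open>C_2pi :: (real \<times> real \<Rightarrow> real) set\<close> is the space of real valued functions and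
  \<open>C_2pi :: (real \<times> real \<Rightarrow> fuzzy) set\<close> the space of fuzzy number valued ones.\<close>

definition C_2pi :: "(real \<times> real \<Rightarrow> 'a::topological_space) set" where
  "C_2pi = {f. periodic_2pi f \<and> continuous_on UNIV f}"

text \<open>On \<open>C_2pi\<close> the functions are bounded, so the suprema below are genuine.\<close>

definition sup_norm :: "(real \<times> real \<Rightarrow> real) \<Rightarrow> real" where
  "sup_norm f = (SUP p. \<bar>f p\<bar>)"

definition sup_dist :: "(real \<times> real \<Rightarrow> fuzzy) \<Rightarrow> (real \<times> real \<Rightarrow> fuzzy) \<Rightarrow> real" where
  "sup_dist f g = (SUP p. dist (f p) (g p))"


section \<open>Operators\<close>

text \<open>Operators are total functions of which only the restriction to \<open>C_2pi\<close> matters.\<close>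

definition positive_linear_operator ::
  "((real \<times> real \<Rightarrow> real) \<Rightarrow> real \<times> real \<Rightarrow> real) \<Rightarrow> bool" where
  "positive_linear_operator T \<longleftrightarrow>
     T \<in> C_2pi \<rightarrow> C_2pi \<and>
     (\<forall>k1 k2. \<forall>f1\<in>C_2pi. \<forall>f2\<in>C_2pi. \<forall>p.
        T (\<lambda>q. k1 * f1 q + k2 * f2 q) p = k1 * T f1 p + k2 * T f2 p) \<and>
     (\<forall>f\<in>C_2pi. (\<forall>p. 0 \<le> f p) \<longrightarrow> (\<forall>p. 0 \<le> T f p))"

definition fuzzy_linear_operator ::
  "((real \<times> real \<Rightarrow> fuzzy) \<Rightarrow> real \<times> real \<Rightarrow> fuzzy) \<Rightarrow> bool" where
  "fuzzy_linear_operator T \<longleftrightarrow>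
     T \<in> C_2pi \<rightarrow> C_2pi \<and>
     (\<forall>k1 k2. \<forall>f1\<in>C_2pi. \<forall>f2\<in>C_2pi. \<forall>p.
        T (\<lambda>q. k1 *\<^sub>R f1 q + k2 *\<^sub>R f2 q) p = k1 *\<^sub>R T f1 p + k2 *\<^sub>R T f2 p)"

definition fuzzy_positive_linear_operator ::
  "((real \<times> real \<Rightarrow> fuzzy) \<Rightarrow> real \<times> real \<Rightarrow> fuzzy) \<Rightarrow> bool" where
  "fuzzy_positive_linear_operator T \<longleftrightarrow>
     fuzzy_linear_operator T \<and>
     (\<forall>f\<in>C_2pi. \<forall>g\<in>C_2pi. (\<forall>p. f p \<le> g p) \<longrightarrow> (\<forall>p. T f p \<le> T g p))"


section \<open>Pringsheim convergence\<close>

definition pringsheim_limit :: "(nat \<Rightarrow> nat \<Rightarrow> real) \<Rightarrow> real \<Rightarrow> bool" where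
  "pringsheim_limit x L \<longleftrightarrow> (\<forall>e>0. \<exists>N. \<forall>m\<ge>N. \<forall>n\<ge>N. \<bar>x m n - L\<bar> < e)"

end

theory Submission
  imports Defs
begin

text \<open>Write \<open>\<Phi>(p, q) = (1 - cos (u - s)) + (1 - cos (v - t))\<close> for \<open>p = (u, v)\<close> and
  \<open>q = (s, t)\<close>. By compactness, a fuzzy valued \<open>f\<close> in \<open>C_2pi\<close> satisfies
  \<open>D (f p) (f q) \<le> \<epsilon> + K * \<Phi>(p, q)\<close>, hence all its endpoint functions satisfy the
  same estimate with a constant \<open>K\<close> that does not depend on the level. For fixed \<open>p\<close>, \<open>\<Phi>(p, \<cdot>)\<close> is a
  combination of the five test functions that vanishes at \<open>p\<close>, so Korovkin's argument bounds
  the error at every endpoint function in terms of the errors at the test functions,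
  uniformly in the level; taking the supremum over the levels gives the claim for \<open>D\<close>.\<close>

section \<open>A periodic gap function and the compactness estimate\<close>

text \<open>The cosines of differences are expanded so that, for fixed \<open>p\<close>, a linear
  combination of the test functions in \<open>q\<close> can be read off.\<close>

definition torus_gap :: "real \<times> real \<Rightarrow> real \<times> real \<Rightarrow> real" where
  "torus_gap p q = 2 - (cos (fst p) * cos (fst q) + sin (fst p) * sin (fst q))
                    - (cos (snd p) * cos (snd q) + sin (snd p) * sin (snd q))"

lemma torus_gap_eq: "torus_gap p q = (1 - cos (fst p - fst q)) + (1 - cos (snd p - snd q))"
  by (simp add: torus_gap_def cos_diff)

lemma torus_gap_nonneg: "0 \<le> torus_gap p q"
  and torus_gap_le_4: "torus_gap p q \<le> 4"
  using cos_le_one[of "fst p - fst q"] cos_le_one[of "snd p - snd q"]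
    cos_ge_minus_one[of "fst p - fst q"] cos_ge_minus_one[of "snd p - snd q"]
  unfolding torus_gap_eq by linarith+

text \<open>Two nonnegative summands with sum 0 force both cosines to be 1, so the coordinates
  differ by multiples of \<open>2 * pi\<close>. A vanishing gap thus serves as congruence modulo the
  period lattice, and no quotient space is needed.\<close>

lemma periodic_2pi_eq_if_torus_gap_0:
  assumes "periodic_2pi f" "torus_gap p q = 0"
  shows "f p = f q"
proof -
  obtain u v s t where pq: "p = (u, v)" "q = (s, t)" by (metis surj_pair)
  have "cos (u - s) = 1" "cos (v - t) = 1"
    using assms(2) cos_le_one[of "u - s"] cos_le_one[of "v - t"]
    unfolding torus_gap_eq pq fst_conv snd_conv by linarith+
  then obtain m n :: int where "u - s = of_int m * 2 * pi" "v - t = of_int n * 2 * pi"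
    unfolding cos_one_2pi_int by blast
  then have uv: "u = s + 2 * of_int m * pi" "v = t + 2 * of_int n * pi" by simp_all
  have "f (s, t) = f (u, t)" "f (u, t) = f (u, v)"
    using assms(1) unfolding periodic_2pi_def uv by blast+
  then show ?thesis by (simp add: pq)
qed

lemma sin_cos_plus_2pi_int:
  fixes x :: real
  shows "sin (x + 2 * of_int n * pi) = sin x" "cos (x + 2 * of_int n * pi) = cos x"
  using sin.plus_of_int[of x n] cos.plus_of_int[of x n] by (simp_all add: ac_simps)

text \<open>The gap is itself periodic in each argument, so the arguments can be replaced one after
  the other.\<close>

lemma torus_gap_cong:
  assumes "torus_gap p p' = 0" "torus_gap q q' = 0"
  shows "torus_gap p q = torus_gap p' q'"
proof -
  have "periodic_2pi (\<lambda>p. torus_gap p q)" "periodic_2pi (\<lambda>q. torus_gap p' q)"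
    by (auto simp: periodic_2pi_def torus_gap_def sin_cos_plus_2pi_int)
  from this[THEN periodic_2pi_eq_if_torus_gap_0] assms show ?thesis by metis
qed

lemma torus_representative:
  obtains p' where "p' \<in> cbox (0, 0) (2 * pi, 2 * pi)" "torus_gap p p' = 0"
proof -
  have *: "\<exists>y\<in>{0..2 * pi}. cos (x - y) = 1" for x :: real
  proof -
    define n where "n = \<lfloor>x / (2 * pi)\<rfloor>"
    have "of_int n \<le> x / (2 * pi)" "x / (2 * pi) < of_int n + 1"
      unfolding n_def by linarith+
    then have "x - of_int n * 2 * pi \<in> {0..2 * pi}" by (auto simp: field_simps)
    moreover have "cos (x - (x - of_int n * 2 * pi)) = 1"
      unfolding cos_one_2pi_int by auto
    ultimately show ?thesis by blast
  qed
  obtain a b where "a \<in> {0..2 * pi}" "b \<in> {0..2 * pi}" "cos (fst p - a) = 1" "cos (snd p - b) = 1"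
    using *[of "fst p"] *[of "snd p"] by blast
  then show thesis by (intro that[of "(a, b)"]) (auto simp: torus_gap_eq cbox_Pair_eq)
qed

text \<open>On the compact set \<open>A\<close> of pairs in the period square whose values are at
  least \<open>e\<close> apart, the gap is positive, since gap 0 would make the values equal. Hence
  distance over gap is bounded there by some \<open>K\<close>; off \<open>A\<close> the term
  \<open>e\<close> suffices. Periodicity carries this to the whole plane.\<close>

lemma dist_le_torus_gap:
  fixes f :: "real \<times> real \<Rightarrow> 'a::metric_space"
  assumes "f \<in> C_2pi" "0 < e"
  obtains K where "0 \<le> K" "\<And>p q. dist (f p) (f q) \<le> e + K * torus_gap p q"
proof -
  let ?Q = "cbox (0, 0) (2 * pi, 2 * pi) :: (real \<times> real) set"
  have per: "periodic_2pi f" and cont: "continuous_on UNIV f"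
    using assms(1) by (auto simp: C_2pi_def)
  have cf: "continuous_on S (\<lambda>z. f (h z))"
    if "continuous_on S h" for S :: "((real \<times> real) \<times> real \<times> real) set" and h
    using continuous_on_compose2[OF cont that] by simp
  define A where "A = (?Q \<times> ?Q) \<inter> {z. e \<le> dist (f (fst z)) (f (snd z))}"
  have "closed {z. e \<le> dist (f (fst z)) (f (snd z))}"
    by (intro closed_Collect_le continuous_intros cf)
  then have A: "compact A"
    unfolding A_def by (intro compact_Int_closed compact_Times compact_cbox)
  have pos: "0 < torus_gap (fst z) (snd z)" if "z \<in> A" for z
    using that assms(2) torus_gap_nonneg[of "fst z" "snd z"]
      periodic_2pi_eq_if_torus_gap_0[OF per, of "fst z" "snd z"]
    by (fastforce simp: A_def)
  define r where "r = (\<lambda>z. dist (f (fst z)) (f (snd z)) / torus_gap (fst z) (snd z))"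
  have "continuous_on A r"
    unfolding r_def
  proof (intro continuous_intros cf)
    show "continuous_on A (\<lambda>z. torus_gap (fst z) (snd z))"
      unfolding torus_gap_def by (intro continuous_intros)
    show "\<forall>z\<in>A. torus_gap (fst z) (snd z) \<noteq> 0" using pos by fastforce
  qed
  then have "bounded (r ` A)"
    using A by (intro compact_imp_bounded compact_continuous_image)
  then obtain K where K: "0 < K" "\<And>z. z \<in> A \<Longrightarrow> \<bar>r z\<bar> \<le> K"
    unfolding bounded_pos by auto
  show thesis
  proof (rule that)
    show "0 \<le> K" using K by simp
    fix p q
    obtain p' q' where pq': "p' \<in> ?Q" "torus_gap p p' = 0" "q' \<in> ?Q" "torus_gap q q' = 0"
      using torus_representative by metis
    have "dist (f p') (f q') \<le> e + K * torus_gap p' q'"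
    proof (cases "(p', q') \<in> A")
      case True
      have "r (p', q') \<le> K" using K(2)[OF True] by linarith
      then have "dist (f p') (f q') \<le> K * torus_gap p' q'"
        using pos[OF True] by (simp add: r_def pos_divide_le_eq)
      then show ?thesis using assms(2) by linarith
    next
      case False
      then have "dist (f p') (f q') < e" using pq' by (auto simp: A_def)
      moreover have "0 \<le> K * torus_gap p' q'" using K(1) torus_gap_nonneg by simp
      ultimately show ?thesis by linarith
    qed
    then show "dist (f p) (f q) \<le> e + K * torus_gap p q"
      using pq' per by (metis periodic_2pi_eq_if_torus_gap_0 torus_gap_cong)
  qed
qed

text \<open>Bounding distances between values, rather than a norm, covers real and fuzzy valued
  functions alike.\<close>

lemma C_2pi_dist_bounded:
  fixes f :: "real \<times> real \<Rightarrow> 'a::metric_space"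
  assumes "f \<in> C_2pi"
  obtains M where "\<And>p q. dist (f p) (f q) \<le> M"
proof -
  obtain K where K: "0 \<le> K" "\<And>p q. dist (f p) (f q) \<le> 1 + K * torus_gap p q"
    using dist_le_torus_gap[OF assms, of 1] by auto
  have "dist (f p) (f q) \<le> 1 + K * 4" for p q
    using K(2)[of p q] mult_left_mono[OF torus_gap_le_4 K(1), of p q] by linarith
  then show thesis using that by blast
qed

lemma C_2pi_lincomb:
  fixes f g :: "real \<times> real \<Rightarrow> real"
  assumes "f \<in> C_2pi" "g \<in> C_2pi"
  shows "(\<lambda>p. a * f p + b * g p) \<in> C_2pi"
  using assms unfolding C_2pi_def periodic_2pi_def
  by (auto intro!: continuous_intros)

text \<open>Membership in \<open>C_2pi\<close> supplies the boundedness that makes the supremum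
  genuine.\<close>

lemma abs_le_sup_norm:
  assumes "f \<in> C_2pi"
  shows "\<bar>f p\<bar> \<le> sup_norm f"
proof -
  obtain M where M: "\<And>p q. dist (f p) (f q) \<le> M" using C_2pi_dist_bounded[OF assms] by blast
  have "\<bar>f p\<bar> \<le> M + \<bar>f 0\<bar>" for p using M[of p 0] by (simp add: dist_real_def)
  then show ?thesis unfolding sup_norm_def by (intro cSUP_upper bdd_aboveI2) auto
qed

lemma test_functions_C_2pi:
  "(\<lambda>(u, v). 1 :: real) \<in> C_2pi" "(\<lambda>(u, v). sin u :: real) \<in> C_2pi"
  "(\<lambda>(u, v). sin v :: real) \<in> C_2pi" "(\<lambda>(u, v). cos u :: real) \<in> C_2pi"
  "(\<lambda>(u, v). cos v :: real) \<in> C_2pi"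
  unfolding C_2pi_def periodic_2pi_def case_prod_unfold
  by (auto intro!: continuous_intros simp: sin_cos_plus_2pi_int)

section \<open>Korovkin's estimate for a single positive linear operator\<close>

lemma positive_linear_operator_mono:
  assumes T: "positive_linear_operator T" and fg: "f \<in> C_2pi" "g \<in> C_2pi" "\<And>p. f p \<le> g p"
  shows "T f p \<le> T g p"
proof -
  have "0 \<le> T (\<lambda>q. 1 * g q + (- 1) * f q) p"
  proof -
    have "\<forall>q. 0 \<le> 1 * g q + (- 1) * f q" using fg(3) by simp
    moreover have "\<forall>h\<in>C_2pi. (\<forall>q. 0 \<le> h q) \<longrightarrow> (\<forall>q. 0 \<le> T h q)"
      using T unfolding positive_linear_operator_def by blast
    ultimately show ?thesis
      using bspec[OF _ C_2pi_lincomb[OF fg(2,1), of 1 "- 1"]] by blast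
  qed
  also have "\<dots> = 1 * T g p + (- 1) * T f p"
    using T fg(1,2) unfolding positive_linear_operator_def by blast
  finally show ?thesis by simp
qed

text \<open>The function \<open>g\<close> minus the constant \<open>g p\<close> lies between
  \<open>-H\<close> and \<open>H\<close>, where \<open>H\<close> is \<open>e\<close> plus
  \<open>K\<close> times the gap from \<open>p\<close>. Positivity then bounds its image at
  \<open>p\<close> by \<open>T H p\<close>, which is \<open>e\<close> plus test function errors
  because the gap vanishes at \<open>p\<close>. The bound involves \<open>g\<close> only through
  \<open>e\<close>, \<open>K\<close> and \<open>B\<close>, hence is uniform over families sharing
  them.\<close>

lemma korovkin_estimate:
  assumes T: "positive_linear_operator T" and g: "g \<in> C_2pi"
    and gK: "\<And>p q. \<bar>g p - g q\<bar> \<le> e + K * torus_gap p q" and B: "\<bar>g p\<bar> \<le> B"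
    and K: "0 \<le> K" and e: "0 \<le> e"
    and err: "\<And>h. h \<in> {\<lambda>(u, v). 1, \<lambda>(u, v). sin u, \<lambda>(u, v). sin v,
                    \<lambda>(u, v). cos u, \<lambda>(u, v). cos v} \<Longrightarrow> \<bar>T h p - h p\<bar> \<le> d"
  shows "\<bar>T g p - g p\<bar> \<le> e + (e + 6 * K + B) * d"
proof -
  have lin: "T (\<lambda>q. a * h q + b * k q) p = a * T h p + b * T k p"
    if "h \<in> C_2pi" "k \<in> C_2pi" for a b h k
    using T that unfolding positive_linear_operator_def by blast
  obtain u v where p: "p = (u, v)" by (metis surj_pair)
  define one s1 s2 c1 c2 :: "real \<times> real \<Rightarrow> real"
    where test_defs: "one = (\<lambda>(u, v). 1)" "s1 = (\<lambda>(u, v). sin u)" "s2 = (\<lambda>(u, v). sin v)"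
      "c1 = (\<lambda>(u, v). cos u)" "c2 = (\<lambda>(u, v). cos v)"
  have mem: "one \<in> C_2pi" "s1 \<in> C_2pi" "s2 \<in> C_2pi" "c1 \<in> C_2pi" "c2 \<in> C_2pi"
    unfolding test_defs by (rule test_functions_C_2pi)+
  have val: "one p = 1" "s1 p = sin u" "s2 p = sin v" "c1 p = cos u" "c2 p = cos v"
    by (simp_all add: test_defs p)
  define G1 where "G1 = (\<lambda>q. cos u * c1 q + sin u * s1 q)"
  define G2 where "G2 = (\<lambda>q. cos v * c2 q + sin v * s2 q)"
  \<comment> \<open>The coefficients 1 and 0 here and below put each function literally into the
    two-term shape for which linearity is stated. The \<open>2 * K\<close> in \<open>H\<close> comes
    from the constant 2 in \<open>torus_gap\<close>.\<close>
  define G where "G = (\<lambda>q. 1 * G1 q + 1 * G2 q)"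
  define H where "H = (\<lambda>q. (e + 2 * K) * one q + (- K) * G q)"
  define H' where "H' = (\<lambda>q. (- 1) * H q + 0 * one q)"
  define F where "F = (\<lambda>q. 1 * g q + (- g p) * one q)"
  have "G1 \<in> C_2pi" "G2 \<in> C_2pi" unfolding G1_def G2_def by (intro C_2pi_lincomb mem)+
  then have "G \<in> C_2pi" unfolding G_def by (intro C_2pi_lincomb)
  then have "H \<in> C_2pi" unfolding H_def by (intro C_2pi_lincomb mem)
  then have "H' \<in> C_2pi" unfolding H'_def by (intro C_2pi_lincomb mem)
  have "F \<in> C_2pi" unfolding F_def by (intro C_2pi_lincomb mem g)
  have H_eq: "H q = e + K * torus_gap p q" for q
    by (simp add: H_def G_def G1_def G2_def test_defs torus_gap_def p case_prod_unfold algebra_simps)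
  have FH: "F q \<le> H q" "H' q \<le> F q" for q
    using gK[of p q] torus_gap_nonneg
    unfolding H'_def H_eq by (auto simp: F_def test_defs case_prod_unfold)
  have "T F p \<le> T H p" "T H' p \<le> T F p"
    using positive_linear_operator_mono[OF T \<open>F \<in> C_2pi\<close> \<open>H \<in> C_2pi\<close> FH(1)]
      positive_linear_operator_mono[OF T \<open>H' \<in> C_2pi\<close> \<open>F \<in> C_2pi\<close> FH(2)] by blast+
  moreover have "T H' p = - T H p"
    unfolding H'_def using lin[OF \<open>H \<in> C_2pi\<close> mem(1), of "- 1" 0] by simp
  ultimately have TF: "\<bar>T F p\<bar> \<le> T H p" by linarith
  have T_F: "T F p = T g p - g p * T one p"
    unfolding F_def using lin[OF g mem(1), of 1 "- g p"] by simp
  have "T H p = (e + 2 * K) * T one p + (- K) * T G p"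
    unfolding H_def by (intro lin mem \<open>G \<in> C_2pi\<close>)
  moreover have "T G p = 1 * T G1 p + 1 * T G2 p"
    unfolding G_def by (intro lin \<open>G1 \<in> C_2pi\<close> \<open>G2 \<in> C_2pi\<close>)
  moreover have "T G1 p = cos u * T c1 p + sin u * T s1 p"
    "T G2 p = cos v * T c2 p + sin v * T s2 p"
    unfolding G1_def G2_def by (intro lin mem)+
  ultimately have T_H: "T H p = (e + 2 * K) * T one p - K *
      ((cos u * T c1 p + sin u * T s1 p) + (cos v * T c2 p + sin v * T s2 p))"
    by simp
  have errs: "\<bar>T one p - 1\<bar> \<le> d" "\<bar>T s1 p - sin u\<bar> \<le> d" "\<bar>T s2 p - sin v\<bar> \<le> d"
    "\<bar>T c1 p - cos u\<bar> \<le> d" "\<bar>T c2 p - cos v\<bar> \<le> d"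
    using err[of one] err[of s1] err[of s2] err[of c1] err[of c2] val
    by (simp_all add: test_defs)
  have weighted: "- (a * x) \<le> d" if "\<bar>a\<bar> \<le> 1" "\<bar>x\<bar> \<le> d" for a x :: real
    using mult_mono[OF that] by (simp add: abs_mult[symmetric])
  have sum_le: "2 * x - y1 - y2 - y3 - y4 \<le> 6 * d"
    if "- y1 \<le> d" "- y2 \<le> d" "- y3 \<le> d" "- y4 \<le> d" "\<bar>x\<bar> \<le> d" for x y1 y2 y3 y4
    using that by linarith
  \<comment> \<open>Each image is split into value plus error; by the Pythagorean identity the
    values multiplied by \<open>K\<close> cancel.\<close>
  have "T H p = e + e * (T one p - 1) + K * (2 * (T one p - 1)
      - cos u * (T c1 p - cos u) - sin u * (T s1 p - sin u)
      - cos v * (T c2 p - cos v) - sin v * (T s2 p - sin v))"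
  proof -
    have "cos u * cos u + sin u * sin u = 1" "cos v * cos v + sin v * sin v = 1"
      using sin_cos_squared_add3 by blast+
    then show ?thesis unfolding T_H by algebra
  qed
  \<comment> \<open>The 6 counts the error at \<open>one\<close> twice and the four trigonometric
    errors once each, with weights of modulus at most 1.\<close>
  also have "\<dots> \<le> e + e * d + K * (6 * d)"
  proof (intro add_mono mult_left_mono e K order_refl)
    show "2 * (T one p - 1)
      - cos u * (T c1 p - cos u) - sin u * (T s1 p - sin u)
      - cos v * (T c2 p - cos v) - sin v * (T s2 p - sin v) \<le> 6 * d"
      using weighted[OF abs_cos_le_one errs(4), of u] weighted[OF abs_sin_le_one errs(2), of u]
        weighted[OF abs_cos_le_one errs(5), of v] weighted[OF abs_sin_le_one errs(3), of v] errs(1)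
      by (rule sum_le)
  qed (use errs(1) in linarith)
  finally have "T H p \<le> e + e * d + K * (6 * d)" .
  moreover have "\<bar>g p * (T one p - 1)\<bar> \<le> B * d"
    unfolding abs_mult by (intro mult_mono B errs) (use B in linarith)+
  \<comment> \<open>The last term accounts for \<open>T\<close> possibly not fixing constants; it
    contributes \<open>B * d\<close>.\<close>
  moreover have "T g p - g p = T F p + g p * (T one p - 1)"
    unfolding T_F by (simp add: algebra_simps)
  moreover have "e + e * d + K * (6 * d) + B * d = e + (e + 6 * K + B) * d"
    by (simp add: algebra_simps)
  ultimately show ?thesis using TF by linarith
qed

section \<open>Endpoint functions of fuzzy valued functions\<close>

text \<open>Endpoint maps are nonexpansive for \<open>D\<close>, so estimates for \<open>f\<close>
  pass to all levels with unchanged constants.\<close>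

lemma endpoint_dist_le:
  assumes "\<alpha> \<in> {0..1}"
  shows "\<bar>lower \<mu> \<alpha> - lower \<eta> \<alpha>\<bar> \<le> dist \<mu> \<eta>" "\<bar>upper \<mu> \<alpha> - upper \<eta> \<alpha>\<bar> \<le> dist \<mu> \<eta>"
  using cSUP_upper[OF assms bdd_above_endpoint_distances[of \<mu> \<eta>]] by (simp_all add: dist_fuzzy_def)

lemma fuzzy_dist_leI:
  assumes "\<And>\<alpha>. \<alpha> \<in> {0..1} \<Longrightarrow> \<bar>lower \<mu> \<alpha> - lower \<eta> \<alpha>\<bar> \<le> c"
    and "\<And>\<alpha>. \<alpha> \<in> {0..1} \<Longrightarrow> \<bar>upper \<mu> \<alpha> - upper \<eta> \<alpha>\<bar> \<le> c"
  shows "dist \<mu> \<eta> \<le> c"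
  unfolding dist_fuzzy_def by (rule cSUP_least) (use assms in auto)

text \<open>Every level interval lies inside the one at level 0, which gives a bound independent of
  the level.\<close>

lemma endpoint_abs_le:
  assumes "\<alpha> \<in> {0..1}"
  shows "\<bar>lower \<mu> \<alpha>\<bar> \<le> \<bar>lower \<mu> 0\<bar> + \<bar>upper \<mu> 0\<bar>" "\<bar>upper \<mu> \<alpha>\<bar> \<le> \<bar>lower \<mu> 0\<bar> + \<bar>upper \<mu> 0\<bar>"
proof -
  have "{lower \<mu> \<alpha>..upper \<mu> \<alpha>} \<subseteq> {lower \<mu> 0..upper \<mu> 0}"
    using assms level_subset_level_0[of \<alpha> \<mu>] level_eq_interval(1)[of \<alpha> \<mu>] level_eq_interval(1)[of 0 \<mu>]
    by simp
  then have "lower \<mu> 0 \<le> lower \<mu> \<alpha> \<and> upper \<mu> \<alpha> \<le> upper \<mu> 0"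
    using level_eq_interval(2)[OF assms, of \<mu>] by simp
  then show "\<bar>lower \<mu> \<alpha>\<bar> \<le> \<bar>lower \<mu> 0\<bar> + \<bar>upper \<mu> 0\<bar>" "\<bar>upper \<mu> \<alpha>\<bar> \<le> \<bar>lower \<mu> 0\<bar> + \<bar>upper \<mu> 0\<bar>"
    using level_eq_interval(2)[OF assms, of \<mu>] by linarith+
qed

lemma C_2pi_lipschitz_image:
  fixes f :: "real \<times> real \<Rightarrow> 'a::metric_space" and h :: "'a \<Rightarrow> 'b::metric_space"
  assumes "f \<in> C_2pi" "\<And>x y. dist (h x) (h y) \<le> dist x y"
  shows "(\<lambda>p. h (f p)) \<in> C_2pi"
proof -
  have "continuous_on UNIV h"
    unfolding continuous_on_iff using assms(2) by (meson le_less_trans)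
  then have "continuous_on UNIV (\<lambda>p. h (f p))"
    using assms(1) by (auto simp: C_2pi_def intro: continuous_on_compose2)
  then show ?thesis using assms(1) unfolding C_2pi_def periodic_2pi_def by simp
qed

lemma endpoint_C_2pi:
  assumes "f \<in> C_2pi" "\<alpha> \<in> {0..1}"
  shows "(\<lambda>p. lower (f p) \<alpha>) \<in> C_2pi" "(\<lambda>p. upper (f p) \<alpha>) \<in> C_2pi"
  using C_2pi_lipschitz_image[OF assms(1), of "\<lambda>\<mu>. lower \<mu> \<alpha>"]
    C_2pi_lipschitz_image[OF assms(1), of "\<lambda>\<mu>. upper \<mu> \<alpha>"]
    endpoint_dist_le[OF assms(2)]
  by (simp_all add: dist_real_def)

section \<open>Passage to the Pringsheim limit\<close>

lemma pringsheim_limit_finite_uniform: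
  assumes "finite A" "\<And>a. a \<in> A \<Longrightarrow> pringsheim_limit (x a) (L a)" "0 < e"
  obtains N where "\<And>a m n. a \<in> A \<Longrightarrow> N \<le> m \<Longrightarrow> N \<le> n \<Longrightarrow> \<bar>x a m n - L a\<bar> < e"
proof -
  have "\<exists>N. \<forall>m\<ge>N. \<forall>n\<ge>N. \<bar>x a m n - L a\<bar> < e" if "a \<in> A" for a
    using assms(2)[OF that] assms(3) unfolding pringsheim_limit_def by blast
  then obtain N where N: "\<And>a m n. a \<in> A \<Longrightarrow> N a \<le> m \<Longrightarrow> N a \<le> n \<Longrightarrow> \<bar>x a m n - L a\<bar> < e"
    by metis
  \<comment> \<open>The sum of the natural thresholds dominates each of them and, unlike a maximum,
    needs no separate case for empty \<open>A\<close>.\<close>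
  have "N a \<le> sum N A" if "a \<in> A" for a
    using assms(1) that by (simp add: member_le_sum)
  then show thesis by (intro that[of "sum N A"]) (meson N order_trans)
qed

theorem theorem2p1:
  fixes T :: "nat \<Rightarrow> nat \<Rightarrow> (real \<times> real \<Rightarrow> fuzzy) \<Rightarrow> real \<times> real \<Rightarrow> fuzzy"
    and T' :: "nat \<Rightarrow> nat \<Rightarrow> (real \<times> real \<Rightarrow> real) \<Rightarrow> real \<times> real \<Rightarrow> real"
  assumes "\<And>m n. fuzzy_positive_linear_operator (T m n)"
    and "\<And>m n. positive_linear_operator (T' m n)"
    and "\<And>m n f \<alpha> u v. f \<in> C_2pi \<Longrightarrow> \<alpha> \<in> {0..1} \<Longrightarrow>
           lower (T m n f (u, v)) \<alpha> = T' m n (\<lambda>p. lower (f p) \<alpha>) (u, v)"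
    and "\<And>m n f \<alpha> u v. f \<in> C_2pi \<Longrightarrow> \<alpha> \<in> {0..1} \<Longrightarrow>
           upper (T m n f (u, v)) \<alpha> = T' m n (\<lambda>p. upper (f p) \<alpha>) (u, v)"
    and "\<And>f. f \<in> {\<lambda>(u, v). 1, \<lambda>(u, v). sin u, \<lambda>(u, v). sin v,
                    \<lambda>(u, v). cos u, \<lambda>(u, v). cos v} \<Longrightarrow>
           pringsheim_limit (\<lambda>m n. sup_norm (\<lambda>p. T' m n f p - f p)) 0"
  shows "\<forall>f\<in>C_2pi. pringsheim_limit (\<lambda>m n. sup_dist (T m n f) f) 0"
  unfolding pringsheim_limit_def
proof (intro ballI allI impI)
  fix f :: "real \<times> real \<Rightarrow> fuzzy" and \<epsilon> :: real
  assume f: "f \<in> C_2pi" and "0 < \<epsilon>"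
  \<comment> \<open>The errors will total \<open>2 * e\<close>; the third share keeps the inequality
    strict after taking suprema.\<close>
  define e where "e = \<epsilon> / 3"
  have e: "0 < e" using \<open>0 < \<epsilon>\<close> by (simp add: e_def)
  obtain K where K: "0 \<le> K" "\<And>p q. dist (f p) (f q) \<le> e + K * torus_gap p q"
    using dist_le_torus_gap[OF f e] by blast
  obtain M where M: "\<And>p q. dist (f p) (f q) \<le> M" using C_2pi_dist_bounded[OF f] by blast
  \<comment> \<open>Comparison with the value at the origin bounds all endpoints, at every point and
    level.\<close>
  define B where "B = M + \<bar>lower (f 0) 0\<bar> + \<bar>upper (f 0) 0\<bar>"
  have B: "\<bar>lower (f p) \<alpha>\<bar> \<le> B" "\<bar>upper (f p) \<alpha>\<bar> \<le> B" if "\<alpha> \<in> {0..1}" for p \<alpha>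
    using endpoint_dist_le[OF that, of "f p" "f 0"] M[of p 0] endpoint_abs_le[OF that, of "f 0"]
    unfolding B_def by linarith+
  \<comment> \<open>This is the factor of \<open>d\<close> in \<open>korovkin_estimate\<close>, so
    test errors of at most \<open>e / C\<close> contribute exactly one further
    \<open>e\<close>.\<close>
  define C where "C = e + 6 * K + B"
  have "0 \<le> B" using B(1)[of 0 0] by simp
  then have C: "0 < C" using e K(1) by (simp add: C_def)
  define tests :: "(real \<times> real \<Rightarrow> real) set" where
    "tests = {\<lambda>(u, v). 1, \<lambda>(u, v). sin u, \<lambda>(u, v). sin v, \<lambda>(u, v). cos u, \<lambda>(u, v). cos v}"
  have "finite tests" "0 < e / C" using e C by (simp_all add: tests_def)
  moreover have "pringsheim_limit (\<lambda>m n. sup_norm (\<lambda>p. T' m n h p - h p)) 0" if "h \<in> tests" for h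
    using that unfolding tests_def by (rule assms(5))
  ultimately obtain N where N: "\<And>h m n. h \<in> tests \<Longrightarrow> N \<le> m \<Longrightarrow> N \<le> n \<Longrightarrow>
      \<bar>sup_norm (\<lambda>p. T' m n h p - h p) - 0\<bar> < e / C"
    using pringsheim_limit_finite_uniform[where x = "\<lambda>h m n. sup_norm (\<lambda>p. T' m n h p - h p)"
        and L = "\<lambda>_. 0" and A = tests and e = "e / C"] by blast
  have main: "\<bar>sup_dist (T m n f) f - 0\<bar> < \<epsilon>" if mn: "N \<le> m" "N \<le> n" for m n
  proof -
    have err: "\<bar>T' m n h p - h p\<bar> \<le> e / C" if "h \<in> tests" for h p
    proof -
      have h: "h \<in> C_2pi" using that test_functions_C_2pi by (auto simp: tests_def)
      then have "T' m n h \<in> C_2pi" using assms(2) unfolding positive_linear_operator_def by blast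
      with h have "(\<lambda>p. 1 * T' m n h p + (- 1) * h p) \<in> C_2pi" by (intro C_2pi_lincomb)
      then have "(\<lambda>p. T' m n h p - h p) \<in> C_2pi" by simp
      from abs_le_sup_norm[OF this, of p] N[OF that mn] show ?thesis by linarith
    qed
    \<comment> \<open>These conditions on \<open>g\<close> hold for the lower and upper endpoint
      functions at every level, so one \<open>N\<close> serves all levels.\<close>
    have est: "\<bar>T' m n g p - g p\<bar> \<le> 2 * e"
      if "g \<in> C_2pi" "\<And>p q. \<bar>g p - g q\<bar> \<le> dist (f p) (f q)" "\<And>p. \<bar>g p\<bar> \<le> B" for g p
    proof -
      have "\<bar>T' m n g p - g p\<bar> \<le> e + (e + 6 * K + B) * (e / C)"
      proof (rule korovkin_estimate[OF assms(2) that(1) _ that(3) K(1)])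
        show "\<bar>g p - g q\<bar> \<le> e + K * torus_gap p q" for p q
          using that(2)[of p q] K(2)[of p q] by linarith
      qed (use e err in \<open>auto simp: tests_def\<close>)
      also have "\<dots> = 2 * e" using C by (simp flip: C_def)
      finally show ?thesis .
    qed
    have le: "dist (T m n f p) (f p) \<le> 2 * e" for p
    proof (rule fuzzy_dist_leI)
      fix \<alpha> :: real assume \<alpha>: "\<alpha> \<in> {0..1}"
      obtain u v where p: "p = (u, v)" by (metis surj_pair)
      show "\<bar>lower (T m n f p) \<alpha> - lower (f p) \<alpha>\<bar> \<le> 2 * e"
        unfolding p assms(3)[OF f \<alpha>]
        by (rule est) (use \<alpha> f B in \<open>simp_all add: endpoint_C_2pi endpoint_dist_le\<close>)
      show "\<bar>upper (T m n f p) \<alpha> - upper (f p) \<alpha>\<bar> \<le> 2 * e"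
        unfolding p assms(4)[OF f \<alpha>]
        by (rule est) (use \<alpha> f B in \<open>simp_all add: endpoint_C_2pi endpoint_dist_le\<close>)
    qed
    \<comment> \<open>The uniform bound \<open>2 * e\<close> also shows the distances bounded above,
      so their supremum dominates the nonnegative value at the origin.\<close>
    have "0 \<le> dist (T m n f 0) (f 0)" by simp
    also have "\<dots> \<le> sup_dist (T m n f) f"
      unfolding sup_dist_def by (intro cSUP_upper bdd_aboveI2[of _ _ "2 * e"] le) simp
    finally have "0 \<le> sup_dist (T m n f) f" .
    moreover have "sup_dist (T m n f) f \<le> 2 * e"
      unfolding sup_dist_def by (intro cSUP_least le) simp
    ultimately show ?thesis using e by (simp add: e_def)
  qed
  then show "\<exists>N. \<forall>m\<ge>N. \<forall>n\<ge>N. \<bar>sup_dist (T m n f) f - 0\<bar> < \<epsilon>" by blast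
qed

end
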